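(* Consider the fully discrete scheme for $u_t+u_x=0$ obtained by applying the modified third-order SSP Runge-Kutta time discretization described in the context to the semi-discrete scheme $\frac{d\boldsymbol{u}_i}{dt}=\frac{1}{\Delta x}\left(\mathbf{A}\boldsymbol{u}_{i-2}+\mathbf{B}\boldsymbol{u}_{i-1}+\mathbf{C}\boldsymbol{u}_i+\mathbf{D}\boldsymbol{u}_{i+1}\right)$ described there. A necessary condition for stability of this scheme is $0<\frac{\Delta t}{\Delta x}\lesssim 0.824$, the bound being understood to three decimal digits; that is, if the scheme is stable for the ratio $\nu=\Delta t/\Delta x>0$, then $\nu<0.825$.
   Context: Equation and mesh: $u_t+u_x=0$ for $x\in[0,2\pi]$, $t>0$, with periodic boundary conditions, on a uniform mesh of $N$ cells ($N\ge 4$) $I_i=[x_{i-1/2},x_{i+1/2}]$ with length $\Delta x=2\pi/N$ and center $x_i$; all cell indices are understood modulo $N$. Unknowns: $\boldsymbol{u}_i=(\bar u_i,\bar v_i)^{\mathsf T}$, approximating the zeroth-order moment $\bar u_i(t)=\frac{1}{\Delta x}\int_{I_i}u(x,t)\,dx$ and the first-order moment $\bar v_i(t)=\frac{1}{\Delta x}\int_{I_i}u(x,t)\frac{x-x_i}{\Delta x}\,dx$. Semi-discrete scheme: $$\frac{d\bar u_i}{dt}=-\frac{1}{\Delta x}\left(u^-_{i+1/2}-u^-_{i-1/2}\right),\qquad \frac{d\bar v_i}{dt}=-\frac{1}{2\Delta x}\left(u^-_{i-1/2}+u^-_{i+1/2}\right)+\frac{1}{\Delta x}\bar u_i,$$ with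 the linear reconstruction $$u^-_{i+1/2}=-\tfrac{79}{456}\bar u_{i-1}+\tfrac{7}{12}\bar u_i+\tfrac{269}{456}\bar u_{i+1}-\tfrac{63}{76}\bar v_{i-1}-\tfrac{177}{76}\bar v_{i+1}.$$ Equivalently, $\frac{d\boldsymbol{u}_i}{dt}=L(\boldsymbol{u})_i:=\frac{1}{\Delta x}\left(\mathbf{A}\boldsymbol{u}_{i-2}+\mathbf{B}\boldsymbol{u}_{i-1}+\mathbf{C}\boldsymbol{u}_i+\mathbf{D}\boldsymbol{u}_{i+1}\right)$ with $$\mathbf{A}=\begin{bmatrix}-\frac{79}{456}&-\frac{63}{76}\\ \frac{79}{912}&\frac{63}{152}\end{bmatrix},\quad \mathbf{B}=\begin{bmatrix}\frac{115}{152}&\frac{63}{76}\\ -\frac{187}{912}&\frac{63}{152}\end{bmatrix},\quad \mathbf{C}=\begin{bmatrix}\frac{1}{152}&-\frac{177}{76}\\ \frac{377}{912}&\frac{177}{152}\end{bmatrix},\quad \mathbf{D}=\begin{bmatrix}-\frac{269}{456}&\frac{177}{76}\\ -\frac{269}{912}&\frac{177}{152}\end{bmatrix}.$$ Modification of the first-order moment: for a grid function $\boldsymbol{u}=(\bar u_i,\bar v_i)_i$, let $H$ be the linear operator $$H(\boldsymbol{u})_i=(\bar u_i,\hat v_i)^{\mathsf T},\qquad \hat v_i=\tfrac{5}{76}\left(\bar u_{i+1}-\bar u_{i-1}\right)-\tfrac{11}{38}\left(\bar v_{i+1}+\bar v_{i-1}\right).$$ Modified third-order SSP Runge-Kutta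 discretization with time step $\Delta t>0$ (the modification $H$ is not applied inside $L$): $$\boldsymbol{u}^{(1)}=H(\boldsymbol{u}^n)+\Delta t\,L(\boldsymbol{u}^n),$$ $$\boldsymbol{u}^{(2)}=\tfrac34H(\boldsymbol{u}^n)+\tfrac14\left(H(\boldsymbol{u}^{(1)})+\Delta t\,L(\boldsymbol{u}^{(1)})\right),$$ $$\boldsymbol{u}^{n+1}=\tfrac13H(\boldsymbol{u}^n)+\tfrac23\left(H(\boldsymbol{u}^{(2)})+\Delta t\,L(\boldsymbol{u}^{(2)})\right).$$ Stability: for a fixed ratio $\nu=\Delta t/\Delta x>0$, the fully discrete scheme is called stable if for every $T>0$ there is a constant $C_T$, independent of $N$, such that for all $N\ge 4$ (with $\Delta x=2\pi/N$, $\Delta t=\nu\Delta x$), all initial data $\boldsymbol{u}^0$ and all $n\ge 0$ with $n\Delta t\le T$, one has $\left(\Delta x\sum_i|\boldsymbol{u}^n_i|^2\right)^{1/2}\le C_T\left(\Delta x\sum_i|\boldsymbol{u}^0_i|^2\right)^{1/2}$. *)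

theory Defs
  imports "HOL-Analysis.Analysis"
begin

text \<open>A grid function assigns to the cell with index \<open>i\<close> the vector of its zeroth-order moment
  (component 1) and first-order moment (component 2). Cell indices modulo \<open>N\<close> are rendered as
  integer indices together with \<open>N\<close>-periodicity.\<close>

type_synonym grid_fun = "int \<Rightarrow> real^2"

definition periodic_grid :: "nat \<Rightarrow> grid_fun \<Rightarrow> bool" where
  "periodic_grid N u \<longleftrightarrow> (\<forall>i. u (i + int N) = u i)"

definition matA :: "real^2^2" where
  "matA = vector [vector [- 79/456, - 63/76], vector [79/912, 63/152]]"

definition matB :: "real^2^2" where
  "matB = vector [vector [115/152, 63/76], vector [- 187/912, 63/152]]"

definition matC :: "real^2^2" where
  "matC = vector [vector [1/152, - 177/76], vector [377/912, 177/152]]"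

definition matD :: "real^2^2" where
  "matD = vector [vector [- 269/456, 177/76], vector [- 269/912, 177/152]]"

definition opL :: "real \<Rightarrow> grid_fun \<Rightarrow> grid_fun" where
  "opL dx u = (\<lambda>i. (1/dx) *\<^sub>R
     (matA *v u (i - 2) + matB *v u (i - 1) + matC *v u i + matD *v u (i + 1)))"

definition opH :: "grid_fun \<Rightarrow> grid_fun" where
  "opH u = (\<lambda>i. vector
     [u i $ 1,
      5/76 * (u (i + 1) $ 1 - u (i - 1) $ 1) - 11/38 * (u (i + 1) $ 2 + u (i - 1) $ 2)])"

definition rk_stage1 :: "real \<Rightarrow> real \<Rightarrow> grid_fun \<Rightarrow> grid_fun" where
  "rk_stage1 dx dt u = (\<lambda>i. opH u i + dt *\<^sub>R opL dx u i)"

definition rk_stage2 :: "real \<Rightarrow> real \<Rightarrow> grid_fun \<Rightarrow> grid_fun" where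
  "rk_stage2 dx dt u = (let u1 = rk_stage1 dx dt u in
     (\<lambda>i. (3/4) *\<^sub>R opH u i + (1/4) *\<^sub>R (opH u1 i + dt *\<^sub>R opL dx u1 i)))"

definition rk_step :: "real \<Rightarrow> real \<Rightarrow> grid_fun \<Rightarrow> grid_fun" where
  "rk_step dx dt u = (let u2 = rk_stage2 dx dt u in
     (\<lambda>i. (1/3) *\<^sub>R opH u i + (2/3) *\<^sub>R (opH u2 i + dt *\<^sub>R opL dx u2 i)))"

definition grid_norm :: "nat \<Rightarrow> real \<Rightarrow> grid_fun \<Rightarrow> real" where
  "grid_norm N dx u = sqrt (dx * (\<Sum>i\<in>{0..<int N}. (norm (u i))\<^sup>2))"

text \<open>\<open>\<nu>\<close> is the fixed ratio of time step to mesh width.\<close>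

definition scheme_stable :: "real \<Rightarrow> bool" where
  "scheme_stable \<nu> \<longleftrightarrow>
     (\<forall>T>0. \<exists>C. \<forall>N\<ge>4. \<forall>u0. periodic_grid N u0 \<longrightarrow>
        (let dx = 2 * pi / real N; dt = \<nu> * dx in
         \<forall>n. real n * dt \<le> T \<longrightarrow>
           grid_norm N dx ((rk_step dx dt ^^ n) u0) \<le> C * grid_norm N dx u0))"

text \<open>The matrix form of the spatial operator agrees with the conservative form of the scheme,
  in which \<open>recon u i\<close> is the reconstructed value at the interface between cells
  \<open>i\<close> and \<open>i + 1\<close>.\<close>

definition recon :: "grid_fun \<Rightarrow> int \<Rightarrow> real" where
  "recon u i = - 79/456 * u (i - 1) $ 1 + 7/12 * u i $ 1 + 269/456 * u (i + 1) $ 1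
     - 63/76 * u (i - 1) $ 2 - 177/76 * u (i + 1) $ 2"

lemma opL_conservative_form:
  "opL dx u i $ 1 = - (1/dx) * (recon u i - recon u (i - 1))"
  "opL dx u i $ 2 = - (1/(2*dx)) * (recon u (i - 1) + recon u i) + (1/dx) * u i $ 1"
  by (cases "dx = 0";
      simp add: opL_def recon_def matA_def matB_def matC_def matD_def
        matrix_vector_mult_def sum_2 field_simps)+

end

theory Submission
  imports Defs
begin

text \<open>Applied to a Fourier mode with phase \<open>\<xi>\<close>, one Runge-Kutta step is multiplication by a
  complex 2-by-2 amplification matrix \<open>G(\<xi>)\<close>. If the scheme is stable, then for
  \<open>\<xi> = 2\<pi>k/N\<close> all powers of \<open>G(\<xi>)\<close> are uniformly bounded, because refining the grid by a
  factor \<open>m\<close> keeps the phase and makes the time steps arbitrarily small. Hence both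
  eigenvalues of \<open>G(\<xi>)\<close> lie in the closed unit disc, which for the trace \<open>t\<close> and the
  determinant \<open>d\<close> gives the Schur-Cohn inequality \<open>|t - cnj t d| \<le> 1 - |d|\<^sup>2\<close>. This is a
  closed condition, so it extends from rational to all phases. The phase with
  \<open>e^(i\<xi>) = (-35 + 12 i)/37\<close>, about \<open>0.895 \<pi>\<close>, is close to the most unstable one near the
  critical ratio and makes \<open>t\<close> and \<open>d\<close> polynomials in \<open>\<nu>\<close> with rational coefficients;
  there the inequality fails for every \<open>\<nu> \<ge> 33/40\<close>.\<close>

subsection \<open>Fourier modes\<close>

definition re_vec :: "complex^2 \<Rightarrow> real^2" where
  "re_vec z = (\<chi> k. Re (z $ k))"

text \<open>Grid functions are real, so the complex mode enters through its real part. The scheme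
  has real coefficients and therefore commutes with taking real parts.\<close>

definition mode :: "real \<Rightarrow> complex^2 \<Rightarrow> grid_fun" where
  "mode \<xi> w = (\<lambda>i. re_vec (cis (\<xi> * real_of_int i) *s w))"

text \<open>Fourier symbol of \<open>dx *\<^sub>R opL dx\<close>; the factor \<open>dx\<close> makes
  it independent of the mesh. For \<open>e\<close> on the unit circle \<open>cnj e\<close> is the
  inverse of \<open>e\<close>, that is, the backward shift.\<close>

definition symL :: "complex \<Rightarrow> complex^2^2" where
  "symL e = (\<chi> i j. of_real (matA $ i $ j) * (cnj e)^2 + of_real (matB $ i $ j) * cnj e
     + of_real (matC $ i $ j) + of_real (matD $ i $ j) * e)"

definition symH :: "complex \<Rightarrow> complex^2^2" where
  "symH e = vector [vector [1, 0], vector [5/76 * (e - cnj e), - 11/38 * (e + cnj e)]]"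

text \<open>Symbol of a forward Euler step with \<open>H\<close> in place of the identity, the
  building block of all three stages.\<close>

definition euler_matrix :: "real \<Rightarrow> complex \<Rightarrow> complex^2^2" where
  "euler_matrix \<nu> e = symH e + \<nu> *\<^sub>R symL e"

definition stage2_matrix :: "real \<Rightarrow> complex \<Rightarrow> complex^2^2" where
  "stage2_matrix \<nu> e =
     (3/4) *\<^sub>R symH e + (1/4) *\<^sub>R (euler_matrix \<nu> e ** euler_matrix \<nu> e)"

definition amplification :: "real \<Rightarrow> complex \<Rightarrow> complex^2^2" where
  "amplification \<nu> e =
     (1/3) *\<^sub>R symH e + (2/3) *\<^sub>R (euler_matrix \<nu> e ** stage2_matrix \<nu> e)"

lemma cis_shift:
  "cis (\<xi> * real_of_int (i + 1)) = cis (\<xi> * real_of_int i) * cis \<xi>"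
  "cis (\<xi> * real_of_int (i - 1)) = cis (\<xi> * real_of_int i) * cnj (cis \<xi>)"
  "cis (\<xi> * real_of_int (i - 2)) = cis (\<xi> * real_of_int i) * (cnj (cis \<xi>))\<^sup>2"
  by (simp_all add: cis_mult cis_cnj power2_eq_square algebra_simps)

lemma opH_mode: "opH (mode \<xi> w) = mode \<xi> (symH (cis \<xi>) *v w)"
  unfolding opH_def mode_def cis_shift
  by (rule ext) (simp add: vec_eq_iff forall_2 re_vec_def symH_def
      matrix_vector_mult_def sum_2 algebra_simps)

lemma opL_mode: "dx *\<^sub>R opL dx (mode \<xi> w) i = mode \<xi> (symL (cis \<xi>) *v w) i" if "dx \<noteq> 0"
  using that unfolding opL_def mode_def cis_shift
  by (simp add: vec_eq_iff forall_2 re_vec_def symL_def power2_eq_square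
      matrix_vector_mult_def sum_2 algebra_simps)

lemma mode_add: "mode \<xi> (v + w) i = mode \<xi> v i + mode \<xi> w i"
  by (simp add: mode_def re_vec_def vec_eq_iff algebra_simps)

lemma mode_scaleR: "mode \<xi> (r *\<^sub>R w) i = r *\<^sub>R mode \<xi> w i"
  by (simp add: mode_def re_vec_def vec_eq_iff algebra_simps)

lemma scaleR_matrix_vector_mult: "(r *\<^sub>R M) *v w = r *\<^sub>R (M *v (w :: complex^'n))"
  by (simp add: vec_eq_iff matrix_vector_mult_def scaleR_sum_right)

lemma matrix_vector_mult_smult: "M *v (a *s w) = a *s (M *v (w :: 'a::comm_semiring_1^'n))"
  by (simp add: vec_eq_iff matrix_vector_mult_def sum_distrib_left algebra_simps)

lemma dt_opL_mode:
  assumes "dx \<noteq> 0" and "dt = \<nu> * dx"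
  shows "dt *\<^sub>R opL dx (mode \<xi> w) i = mode \<xi> (\<nu> *\<^sub>R (symL (cis \<xi>) *v w)) i"
  using opL_mode[OF assms(1), of \<xi> w i] by (simp add: assms(2) mode_scaleR flip: scaleR_scaleR)

lemma euler_mode:
  assumes "dx \<noteq> 0" and "dt = \<nu> * dx"
  shows "opH (mode \<xi> w) i + dt *\<^sub>R opL dx (mode \<xi> w) i = mode \<xi> (euler_matrix \<nu> (cis \<xi>) *v w) i"
  using assms
  by (simp add: opH_mode dt_opL_mode euler_matrix_def mode_add matrix_vector_mult_add_rdistrib
      scaleR_matrix_vector_mult)

lemma rk_step_mode:
  assumes "dx \<noteq> 0" and "dt = \<nu> * dx"
  shows "rk_step dx dt (mode \<xi> w) = mode \<xi> (amplification \<nu> (cis \<xi>) *v w)"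
proof -
  let ?P = "euler_matrix \<nu> (cis \<xi>)"
  have 1: "rk_stage1 dx dt (mode \<xi> w) = mode \<xi> (?P *v w)"
    unfolding rk_stage1_def by (rule ext) (rule euler_mode[OF assms])
  have 2: "rk_stage2 dx dt (mode \<xi> w) = mode \<xi> (stage2_matrix \<nu> (cis \<xi>) *v w)"
    unfolding stage2_matrix_def rk_stage2_def Let_def 1 euler_mode[OF assms]
    by (rule ext) (simp only: opH_mode mode_add mode_scaleR matrix_vector_mult_add_rdistrib
      scaleR_matrix_vector_mult matrix_vector_mul_assoc)
  show ?thesis
    unfolding rk_step_def Let_def 2 euler_mode[OF assms] amplification_def
    by (rule ext) (simp only: opH_mode mode_add mode_scaleR matrix_vector_mult_add_rdistrib
      scaleR_matrix_vector_mult matrix_vector_mul_assoc[symmetric])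
qed

lemma rk_iterate_mode:
  assumes "dx \<noteq> 0" and "dt = \<nu> * dx"
  shows "(rk_step dx dt ^^ n) (mode \<xi> w) = mode \<xi> (((*v) (amplification \<nu> (cis \<xi>)) ^^ n) w)"
  by (induction n) (simp_all add: rk_step_mode[OF assms])

lemma periodic_grid_mode:
  assumes "\<xi> * real N = 2 * pi * of_int k"
  shows "periodic_grid N (mode \<xi> w)"
proof -
  have "cis (\<xi> * real_of_int (i + int N)) = cis (\<xi> * real_of_int i)" for i
  proof -
    have "cis (\<xi> * real N) = 1"
      using assms by (simp add: cis_multiple_2pi)
    then show ?thesis by (simp add: distrib_left flip: cis_mult)
  qed
  then show ?thesis by (simp add: periodic_grid_def mode_def)
qed

lemma norm_vec2_sq: "(norm (z :: 'a::real_normed_vector^2))\<^sup>2 = (norm (z $ 1))\<^sup>2 + (norm (z $ 2))\<^sup>2"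
  by (simp add: norm_vec_def L2_set_def sum_2)

lemma norm_smult_complex: "norm (a *s z) = cmod a * norm (z :: complex^'n)"
  by (simp add: norm_vec_def L2_set_right_distrib norm_mult)

text \<open>The two real modes with coefficients \<open>w\<close> and \<open>\<i> w\<close> are the real and (negated)
  imaginary parts of the same complex mode, so their squared norms add up without any
  cross terms, also when \<open>\<xi>\<close> is a multiple of \<open>\<pi>\<close>.\<close>

lemma norm_mode_sq:
  "(norm (mode \<xi> w i))\<^sup>2 + (norm (mode \<xi> (\<i> *s w) i))\<^sup>2 = (norm w)\<^sup>2"
proof -
  have "(Re z)\<^sup>2 + (Re (\<i> * z))\<^sup>2 = (cmod z)\<^sup>2" for z
    by (simp add: cmod_power2)
  then have "(norm (re_vec v))\<^sup>2 + (norm (re_vec (\<i> *s v)))\<^sup>2 = (norm v)\<^sup>2" for v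
    unfolding norm_vec2_sq re_vec_def by (simp add: algebra_simps)
  from this[of "cis (\<xi> * of_int i) *s w"] show ?thesis
    by (simp add: mode_def norm_smult_complex vector_smult_assoc mult.commute)
qed

lemma grid_norm_mode_sq:
  assumes "0 \<le> dx"
  shows "(grid_norm N dx (mode \<xi> w))\<^sup>2 + (grid_norm N dx (mode \<xi> (\<i> *s w)))\<^sup>2
    = dx * real N * (norm w)\<^sup>2"
proof -
  have "(grid_norm N dx u)\<^sup>2 = dx * (\<Sum>i\<in>{0..<int N}. (norm (u i))\<^sup>2)" for u
    using assms by (simp add: grid_norm_def sum_nonneg)
  then show ?thesis
    by (simp add: norm_mode_sq flip: distrib_left sum.distrib)
qed

lemma iterate_smult:
  fixes M :: "complex^'n^'n"
  shows "((*v) M ^^ n) (a *s w) = a *s ((*v) M ^^ n) w"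
  by (induction n) (simp_all add: matrix_vector_mult_smult)

subsection \<open>Power boundedness and the unit disc\<close>

lemma stable_imp_power_bounded:
  assumes "\<nu> > 0" and "scheme_stable \<nu>"
  obtains C where "\<And>n w N k. 0 < N \<Longrightarrow>
    norm (((*v) (amplification \<nu> (cis (2 * pi * of_int k / real N))) ^^ n) w) \<le> C * norm w"
proof -
  from assms(2)[unfolded scheme_stable_def, rule_format, of 1] obtain C where
    C: "\<And>N u0 n. \<lbrakk>N \<ge> 4; periodic_grid N u0; real n * (\<nu> * (2 * pi / real N)) \<le> 1\<rbrakk> \<Longrightarrow>
      grid_norm N (2 * pi / real N) ((rk_step (2 * pi / real N) (\<nu> * (2 * pi / real N)) ^^ n) u0)
        \<le> C * grid_norm N (2 * pi / real N) u0"
    by (auto simp: Let_def)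
  have "norm (((*v) (amplification \<nu> (cis (2 * pi * of_int k / real N))) ^^ n) w) \<le> \<bar>C\<bar> * norm w"
    if "0 < N" for n w N and k :: int
  proof -
    define \<xi> where "\<xi> = 2 * pi * of_int k / real N"
    \<comment> \<open>On a grid with at least \<open>m0\<close> cells, \<open>n\<close> steps end
      before time 1; adding 4 meets the lower bound on the number of cells.\<close>
    obtain m0 :: nat where m0: "real n * \<nu> * 2 * pi \<le> real m0"
      using real_arch_simple by blast
    define m where "m = m0 + 4"
    define N' where "N' = m * N"
    have N'm: "m \<le> N'" using that by (simp add: N'_def)
    then have N': "4 \<le> N'" "real m0 \<le> real N'" by (simp_all add: m_def)
    define dx where "dx = 2 * pi / real N'"
    define dt where "dt = \<nu> * dx"
    have dx: "dx > 0" "dx * real N' = 2 * pi" using N' by (simp_all add: dx_def)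
    have small: "real n * dt \<le> 1"
      using m0 N' by (simp add: dt_def dx_def field_simps)
    \<comment> \<open>On the refined grid the same phase belongs to the wave number
      \<open>m * k\<close>.\<close>
    have per: "periodic_grid N' (mode \<xi> v)" for v
      by (rule periodic_grid_mode[of _ _ "int m * k"])
        (use that in \<open>simp add: \<xi>_def N'_def field_simps\<close>)
    let ?G = "(*v) (amplification \<nu> (cis \<xi>)) ^^ n"
    \<comment> \<open>Squaring removes the unknown sign of \<open>C\<close> and lets the bounds for
      \<open>w\<close> and \<open>\<i> *s w\<close> be added.\<close>
    have bound: "(grid_norm N' dx (mode \<xi> (?G v)))\<^sup>2 \<le> C\<^sup>2 * (grid_norm N' dx (mode \<xi> v))\<^sup>2" for v
    proof -
      have "grid_norm N' dx (mode \<xi> (?G v)) \<le> C * grid_norm N' dx (mode \<xi> v)"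
        using C[OF N'(1) per, of n v] small dx(1) rk_iterate_mode[of dx dt \<nu> n \<xi> v]
        by (simp add: dt_def flip: dx_def)
      moreover have "0 \<le> grid_norm N' dx (mode \<xi> (?G v))"
        using dx(1) by (simp add: grid_norm_def sum_nonneg)
      ultimately show ?thesis using power_mono by (fastforce simp flip: power_mult_distrib)
    qed
    have "2 * pi * (norm (?G w))\<^sup>2
        = (grid_norm N' dx (mode \<xi> (?G w)))\<^sup>2 + (grid_norm N' dx (mode \<xi> (?G (\<i> *s w))))\<^sup>2"
      using grid_norm_mode_sq[of dx N' \<xi> "?G w"] dx by (simp add: iterate_smult)
    also have "\<dots> \<le> C\<^sup>2 * (grid_norm N' dx (mode \<xi> w))\<^sup>2
        + C\<^sup>2 * (grid_norm N' dx (mode \<xi> (\<i> *s w)))\<^sup>2"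
      by (intro add_mono bound)
    also have "\<dots> = C\<^sup>2 * (2 * pi * (norm w)\<^sup>2)"
      using grid_norm_mode_sq[of dx N' \<xi> w] dx by (simp flip: distrib_left)
    finally have "2 * pi * (norm (?G w))\<^sup>2 \<le> C\<^sup>2 * (2 * pi * (norm w)\<^sup>2)" .
    then have "(norm (?G w))\<^sup>2 \<le> (\<bar>C\<bar> * norm w)\<^sup>2"
      by (simp add: power_mult_distrib)
    then show ?thesis by (simp add: \<xi>_def power2_le_iff_abs_le)
  qed
  then show thesis by (rule that)
qed

section \<open>Eigenvalues of power bounded matrices\<close>

lemma eigenvector_exists:
  fixes M :: "complex^'n^'n"
  assumes "det (M - mat a) = 0"
  obtains x where "x \<noteq> 0" "M *v x = a *s x"
proof -
  have "\<not> (\<exists>B. B ** (M - mat a) = mat 1)"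
    using assms invertible_det_nz[of "M - mat a"] invertible_left_inverse by blast
  then obtain x where "x \<noteq> 0" "(M - mat a) *v x = 0"
    by (auto simp: matrix_left_invertible_ker)
  moreover have "mat a *v x = a *s x"
    by (simp add: vec_eq_iff matrix_vector_mult_def mat_def if_distrib if_distribR cong: if_cong)
  ultimately show thesis
    by (intro that) (simp_all add: matrix_vector_mult_diff_rdistrib)
qed

lemma power_bounded_imp_eigenvalue_le_1:
  fixes M :: "complex^'n^'n"
  assumes "\<And>n w. norm (((*v) M ^^ n) w) \<le> C * norm w" and "det (M - mat a) = 0"
  shows "cmod a \<le> 1"
proof (rule ccontr)
  assume "\<not> cmod a \<le> 1"
  obtain x where x: "x \<noteq> 0" "M *v x = a *s x"
    using eigenvector_exists[OF assms(2)] .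
  have "((*v) M ^^ n) x = a ^ n *s x" for n
    by (induction n) (simp_all add: x matrix_vector_mult_smult vector_smult_assoc mult.commute)
  then have "cmod a ^ n \<le> C" for n
    using assms(1)[of n x] x(1) by (simp add: norm_smult_complex norm_power)
  then show False
    using real_arch_pow[of "cmod a" C] \<open>\<not> cmod a \<le> 1\<close> by (meson not_le)
qed

text \<open>With \<open>t = a + b\<close> and \<open>d = a b\<close> one has
  \<open>t - cnj t d = a (1 - \<bar>b\<bar>\<^sup>2) + b (1 - \<bar>a\<bar>\<^sup>2)\<close>.\<close>

lemma schur_cohn_necessary:
  assumes "cmod a \<le> 1" "cmod b \<le> 1"
  shows "cmod ((a + b) - cnj (a + b) * (a * b)) \<le> 1 - (cmod (a * b))\<^sup>2"
proof -
  have sq: "z * cnj z = of_real ((cmod z)\<^sup>2)" for z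
    using complex_norm_square[of z] by simp
  have "(a + b) - cnj (a + b) * (a * b)
      = a * (1 - b * cnj b) + b * (1 - a * cnj a)"
    by (simp add: algebra_simps)
  also have "\<dots> = a * of_real (1 - (cmod b)\<^sup>2) + b * of_real (1 - (cmod a)\<^sup>2)"
    by (simp only: sq) simp
  also have "cmod \<dots> \<le> cmod a * \<bar>1 - (cmod b)\<^sup>2\<bar> + cmod b * \<bar>1 - (cmod a)\<^sup>2\<bar>"
    by (metis norm_triangle_ineq norm_mult norm_of_real)
  also have "\<dots> = cmod a * (1 - (cmod b)\<^sup>2) + cmod b * (1 - (cmod a)\<^sup>2)"
    using assms by (simp add: power_le_one)
  \<comment> \<open>With \<open>p = cmod a\<close> and \<open>q = cmod b\<close>, both sides equal
    \<open>(p + q) * (1 - p * q)\<close>; the subtracted product is the nonnegative slack.\<close>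
  also have "\<dots> = 1 - (cmod a * cmod b)\<^sup>2 - (1 - cmod a * cmod b) * ((1 - cmod a) * (1 - cmod b))"
    by (simp add: algebra_simps power2_eq_square)
  also have "\<dots> \<le> 1 - (cmod a * cmod b)\<^sup>2"
    using assms by (simp add: mult_le_one)
  finally show ?thesis by (simp add: norm_mult)
qed

lemma power_bounded_imp_schur_cohn:
  fixes M :: "complex^2^2"
  assumes "\<And>n w. norm (((*v) M ^^ n) w) \<le> C * norm w"
  shows "cmod (trace M - cnj (trace M) * det M) \<le> 1 - (cmod (det M))\<^sup>2"
proof -
  \<comment> \<open>Root of the discriminant of the characteristic polynomial; \<open>a\<close> and
    \<open>b\<close> below are the eigenvalues, with multiplicity.\<close>
  define r where "r = csqrt ((trace M)\<^sup>2 - 4 * det M)"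
  have r: "r * r = (trace M)\<^sup>2 - 4 * det M"
    by (simp add: r_def flip: power2_eq_square)
  define a where "a = (trace M + r) / 2"
  define b where "b = (trace M - r) / 2"
  have ab: "a + b = trace M" "a * b = det M"
    using r by (simp_all add: a_def b_def field_simps power2_eq_square)
  have root: "det (M - mat z) = (z - a) * (z - b)" for z
  proof -
    have "det (M - mat z) = z * z - z * trace M + det M"
      by (simp add: det_2 trace_def sum_2 mat_def algebra_simps)
    then show ?thesis by (simp add: algebra_simps flip: ab)
  qed
  have "cmod a \<le> 1" "cmod b \<le> 1"
    by (rule power_bounded_imp_eigenvalue_le_1[OF assms], simp add: root)+
  from schur_cohn_necessary[OF this] show ?thesis by (simp add: ab)
qed

section \<open>From rational phases to all phases\<close>

lemma continuous_amplification: "continuous_on UNIV (\<lambda>\<xi>. amplification \<nu> (cis \<xi>))"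
proof -
  have symH_vec: "symH e $ 1 $ 1 = 1" "symH e $ 1 $ 2 = 0"
    "symH e $ 2 $ 1 = 5/76 * (e - cnj e)" "symH e $ 2 $ 2 = - 11/38 * (e + cnj e)" for e
    by (simp_all add: symH_def)
  have mm: "continuous_on UNIV (\<lambda>x. A x ** B x)"
    if "continuous_on UNIV A" "continuous_on UNIV B" for A B :: "real \<Rightarrow> complex^2^2"
    unfolding matrix_matrix_mult_def by (intro continuous_intros that)
  have "continuous_on UNIV (\<lambda>\<xi>. symH (cis \<xi>) $ i $ j)" for i j
    using exhaust_2[of i] exhaust_2[of j]
    by (elim disjE; simp add: symH_vec; intro continuous_intros; simp)
  then have "continuous_on UNIV (\<lambda>\<xi>. \<chi> i j. symH (cis \<xi>) $ i $ j)"
    by (intro continuous_on_vec_lambda)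
  then have H: "continuous_on UNIV (\<lambda>\<xi>. symH (cis \<xi>))" by simp
  have L: "continuous_on UNIV (\<lambda>\<xi>. symL (cis \<xi>))"
    unfolding symL_def by (intro continuous_intros)
  show ?thesis
    unfolding amplification_def stage2_matrix_def euler_matrix_def
    by (intro continuous_intros mm H L)
qed

text \<open>The phases occurring on finite grids are the rational multiples of
  \<open>2 * pi\<close>, which are dense in the reals.\<close>

lemma closed_contains_rational_multiples:
  fixes S :: "real set"
  assumes "closed S" and "\<And>k N. 0 < N \<Longrightarrow> 2 * pi * of_int k / real N \<in> S"
  shows "S = UNIV"
proof -
  have "x \<in> closure S" for x
  proof (subst closure_approachable, intro allI impI)
    fix \<epsilon> :: real assume "\<epsilon> > 0"
    then obtain q where q: "q \<in> \<rat>" "x / (2 * pi) < q" "q < (x + \<epsilon>) / (2 * pi)"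
      using Rats_dense_in_real[of "x / (2 * pi)" "(x + \<epsilon>) / (2 * pi)"]
      by (auto simp: divide_strict_right_mono)
    from q(1) obtain k :: int and N :: nat where kN: "0 < N" "q = of_int k / of_nat N"
    proof -
      from q(1) obtain a b :: int where "b > 0" "q = of_int a / of_int b"
        by (auto elim: Rats_cases')
      then show thesis by (intro that[of "nat b" a]) simp_all
    qed
    have "2 * pi * q \<in> S" using assms(2)[OF kN(1), of k] kN(2) by simp
    moreover have "dist (2 * pi * q) x < \<epsilon>"
      using q by (simp add: dist_real_def field_simps)
    ultimately show "\<exists>y\<in>S. dist y x < \<epsilon>" by blast
  qed
  then show ?thesis using assms(1) by auto
qed

lemma stable_imp_schur_cohn:
  assumes "\<nu> > 0" and "scheme_stable \<nu>" and "cmod e = 1"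
  defines "G \<equiv> amplification \<nu> e"
  shows "cmod (trace G - cnj (trace G) * det G) \<le> 1 - (cmod (det G))\<^sup>2"
proof -
  let ?G = "\<lambda>\<xi>. amplification \<nu> (cis \<xi>)"
  define S where "S = {\<xi>. cmod (trace (?G \<xi>) - cnj (trace (?G \<xi>)) * det (?G \<xi>))
    \<le> 1 - (cmod (det (?G \<xi>)))\<^sup>2}"
  obtain C where C: "\<And>n w N k. 0 < N \<Longrightarrow>
    norm (((*v) (?G (2 * pi * of_int k / real N)) ^^ n) w) \<le> C * norm w"
    using stable_imp_power_bounded[OF assms(1,2)] by metis
  have "closed S"
    unfolding S_def trace_def det_2
    by (intro closed_Collect_le continuous_on_diff continuous_on_mult continuous_on_norm
        continuous_on_const continuous_on_power continuous_on_cnj continuous_on_sum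
        continuous_on_component continuous_amplification)
  moreover have "2 * pi * of_int k / real N \<in> S" if "0 < N" for k N
    unfolding S_def using power_bounded_imp_schur_cohn[OF C[OF that]] by simp
  ultimately have "S = UNIV" by (rule closed_contains_rational_multiples)
  then have "Arg e \<in> S" by simp
  moreover have "cis (Arg e) = e"
    using assms(3) cis_Arg[of e] by (cases "e = 0") (simp_all add: sgn_div_norm)
  ultimately show ?thesis by (simp add: S_def G_def)
qed

subsection \<open>The unstable phase\<close>

text \<open>The Pythagorean triple (12, 35, 37) puts this point exactly on the unit circle with
  rational coordinates.\<close>

definition unstable_phase :: complex where
  "unstable_phase = Complex (-35/37) (12/37)"

lemma symH_unstable_phase:
    "symH unstable_phase $ 1 $ 1 = Complex 1 0"
    "symH unstable_phase $ 1 $ 2 = Complex 0 0"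
    "symH unstable_phase $ 2 $ 1 = Complex 0 (30/703)"
    "symH unstable_phase $ 2 $ 2 = Complex (385/703) 0"
  by (simp_all add: symH_def unstable_phase_def complex_eq_iff)

text \<open>The denominator is \<open>26011 = 19 * 37^2\<close>: 19 comes from the coefficients of
  the scheme and \<open>37^2\<close> from the square of the phase factor.\<close>

lemma euler_matrix_unstable_phase:
    "euler_matrix \<nu> unstable_phase $ 1 $ 1 =
      Complex (1 - 7488/26011 * \<nu>)
        (- 14124/26011 * \<nu>)"
    "euler_matrix \<nu> unstable_phase $ 1 $ 2 =
      Complex (- 155304/26011 * \<nu>)
        (- 576/26011 * \<nu>)"
    "euler_matrix \<nu> unstable_phase $ 2 $ 1 =
      Complex (24834/26011 * \<nu>)
        (30/703 + 624/26011 * \<nu>)"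
    "euler_matrix \<nu> unstable_phase $ 2 $ 2 =
      Complex (385/703 - 48/26011 * \<nu>)
        (12942/26011 * \<nu>)"
  by (simp_all add: euler_matrix_def symH_unstable_phase symL_def matA_def matB_def matC_def matD_def
      complex_eq_iff power2_eq_square) (simp_all add: unstable_phase_def field_simps)

lemma stage2_matrix_unstable_phase:
    "stage2_matrix \<nu> unstable_phase $ 1 $ 1 =
      Complex (1 - 2627712/18285733 * \<nu> - 999969336/676572121 * \<nu>^2)
        (- 6129366/18285733 * \<nu> + 25076736/676572121 * \<nu>^2)"
    "stage2_matrix \<nu> unstable_phase $ 1 $ 2 =
      Complex (- 42242688/18285733 * \<nu> + 292422528/676572121 * \<nu>^2)
        (- 156672/18285733 * \<nu> + 46977516/676572121 * \<nu>^2)"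
    "stage2_matrix \<nu> unstable_phase $ 2 $ 1 =
      Complex (6763713/18285733 * \<nu> - 46602864/676572121 * \<nu>^2)
        (47955/988418 + 113208/18285733 * \<nu> - 8514063/676572121 * \<nu>^2)"
    "stage2_matrix \<nu> unstable_phase $ 2 $ 2 =
      Complex (480095/988418 - 4920/18285733 * \<nu> - 1005988293/676572121 * \<nu>^2)
        (1326555/18285733 * \<nu> - 28114128/676572121 * \<nu>^2)"
  by (simp_all add: stage2_matrix_def matrix_matrix_mult_def sum_2 symH_unstable_phase
      euler_matrix_unstable_phase complex_eq_iff)
    (simp_all add: field_simps power2_eq_square)

lemma amplification_unstable_phase:
    "amplification \<nu> unstable_phase $ 1 $ 1 =
      Complex (1 - 3689404992/12854870299 * \<nu> - 1213493184720/475630201063 * \<nu>^2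
          + 10049774198400/17598317439331 * \<nu>^3)
        (- 10008635916/12854870299 * \<nu> + 52774592256/475630201063 * \<nu>^2
            + 10189935728208/17598317439331 * \<nu>^3)"
    "amplification \<nu> unstable_phase $ 1 $ 2 =
      Complex (- 44651297736/12854870299 * \<nu> + 347467760640/475630201063 * \<nu>^2
          + 103127775109776/17598317439331 * \<nu>^3)
        (- 165605184/12854870299 * \<nu> + 283211743464/475630201063 * \<nu>^2
            + 309161577600/17598317439331 * \<nu>^3)"
    "amplification \<nu> unstable_phase $ 2 $ 1 =
      Complex (9833853324/12854870299 * \<nu> - 54610717536/475630201063 * \<nu>^2
          - 16490973621780/17598317439331 * \<nu>^3)
        (20980495/347428927 + 181326144/12854870299 * \<nu>
            - 66401881470/475630201063 * \<nu>^2 - 402633863136/17598317439331 * \<nu>^3)"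
    "amplification \<nu> unstable_phase $ 2 $ 2 =
      Complex (125035680/347428927 - 5810880/12854870299 * \<nu>
          - 969893338266/475630201063 * \<nu>^2 + 5096565048672/17598317439331 * \<nu>^3)
        (1566758520/12854870299 * \<nu> - 21619228320/475630201063 * \<nu>^2
            - 7779359813364/17598317439331 * \<nu>^3)"
  by (simp_all add: amplification_def matrix_matrix_mult_def sum_2 symH_unstable_phase
      stage2_matrix_unstable_phase euler_matrix_unstable_phase complex_eq_iff)
    (simp_all add: field_simps power2_eq_square power3_eq_cube)

lemma trace_amplification_unstable_phase:
  "trace (amplification \<nu> unstable_phase) = Complex
    ((23931749738371 - 5058750528768 * \<nu> - 80785301350482 * \<nu>^2
        + 15146339247072 * \<nu>^3) / 17598317439331)
    ((- 11556930155124 * \<nu> + 1152748465632 * \<nu>^2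
        + 2410575914844 * \<nu>^3) / 17598317439331)"
  unfolding trace_def sum_2 amplification_unstable_phase
  by (simp add: complex_eq_iff add_divide_distrib diff_divide_distrib)

text \<open>Cancellation lowers the common denominator from \<open>26011^6\<close>, the square of
  that of the trace, to \<open>19^3 * 37^9\<close>.\<close>

lemma det_amplification_unstable_phase:
  "det (amplification \<nu> unstable_phase) = Complex
    ((320807346243273120 - 93169563062822400 * \<nu> - 150989487689493522 * \<nu>^2
        + 76839391741773024 * \<nu>^3 - 2698297821871371936 * \<nu>^4
        - 433824661006089984 * \<nu>^5 + 5270267678428653696 * \<nu>^6) / 891407573254433143)
    ((45847620933871680 * \<nu> - 22654998443187360 * \<nu>^2 - 222899643615151548 * \<nu>^3
        - 139817302539368832 * \<nu>^4 + 1201691850439231584 * \<nu>^5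
        + 58642125266451456 * \<nu>^6) / 891407573254433143)"
  unfolding det_2 amplification_unstable_phase complex_eq_iff add_divide_distrib diff_divide_distrib
  by (simp add: eval_nat_numeral algebra_simps)

text \<open>The bounded quantity is \<open>Re (c (t - cnj t d)) + |d|\<^sup>2 - 1\<close> up to a positive factor, for
  \<open>t = (t1 + i t2)/kt\<close>, \<open>d = (d1 + i d2)/kd\<close> and \<open>c = (-99 + 14 i)/100\<close>. The number \<open>c\<close> lies
  in the unit disc and is close to the direction conjugate to \<open>t - cnj t d\<close> at \<open>\<nu> = 33/40\<close>.
  Expanded in powers of \<open>\<nu> - 33/40\<close>, only the quadratic coefficient is negative; the term
  with \<open>s (s - 2)\<^sup>2\<close> absorbs it.\<close>

lemma schur_cohn_polynomial_pos:
  fixes \<nu> :: real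
  assumes "33/40 \<le> \<nu>"
  defines "t1 \<equiv> 23931749738371 - 5058750528768 * \<nu> - 80785301350482 * \<nu>^2
      + 15146339247072 * \<nu>^3"
    and "t2 \<equiv> - 11556930155124 * \<nu> + 1152748465632 * \<nu>^2 + 2410575914844 * \<nu>^3"
    and "d1 \<equiv> 320807346243273120 - 93169563062822400 * \<nu>
        - 150989487689493522 * \<nu>^2 + 76839391741773024 * \<nu>^3
        - 2698297821871371936 * \<nu>^4 - 433824661006089984 * \<nu>^5
        + 5270267678428653696 * \<nu>^6"
    and "d2 \<equiv> 45847620933871680 * \<nu> - 22654998443187360 * \<nu>^2
        - 222899643615151548 * \<nu>^3 - 139817302539368832 * \<nu>^4
        + 1201691850439231584 * \<nu>^5 + 58642125266451456 * \<nu>^6"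
    and "kt \<equiv> 17598317439331" and "kd \<equiv> 891407573254433143"
  shows "0 < - 99 * (t1 * kd^2 - (t1 * d1 + t2 * d2) * kd)
    - 14 * (t2 * kd^2 - (t1 * d2 - t2 * d1) * kd) + 100 * kt * (d1^2 + d2^2 - kd^2)" (is "0 < ?F")
proof -
  \<comment> \<open>Moves the critical ratio 33/40 to 0; the factor \<open>40^10\<close> below makes
    all coefficients in \<open>s\<close> integers.\<close>
  define s where "s = 40 * \<nu> - 33"
  have "0 \<le> s" using assms(1) by (simp add: s_def)
  then have "0 < 3018793583426839368388357590157583928427985225463186643095206912
      + 27866677809142970009996351797835976711142523993142345058191003648 * s
      + 3772266405164350002134999322059009351923749305385930114811250688 * s^2
      + 25769124277329322904201398721657440537489376158273764703332618240 * (s * (s - 2)^2)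
      + 5322002540530369144976718226346018280070751156736804143088768000 * s^4
      + 438228136065475398872410391942290016512770164469902054819831808 * s^5
      + 21215074814308055899141459251336984247911631921950098658865152 * s^6
      + 673159639387266648339076430945671131641498643985776445366272 * s^7
      + 14560922598785576952509111393707998755284774098886974612480 * s^8
      + 214780918915210257079425648980967081462440476521212006400 * s^9
      + 2078062721207257696815886364371169729558897624900487168 * s^10
      + 11904464646498313584814418790580246311843683854159872 * s^11
      + 30554155073601284434569693437141875702342507564032 * s^12"
    \<comment> \<open>The constant term gives strictness; every other summand is nonnegative for
      \<open>s \<ge> 0\<close>.\<close>
    by (intro add_pos_nonneg) simp_all
  also have "\<dots> = 40^10 * ?F"
    unfolding s_def t1_def t2_def d1_def d2_def kt_def kd_def by algebra
  finally show ?thesis by simp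
qed

text \<open>For \<open>c\<close> in the unit disc, \<open>Re (c * w) \<le> cmod w\<close>. Replacing
  the modulus by this real linear functional avoids the square root and leaves a polynomial
  inequality.\<close>

lemma schur_cohn_violated:
  fixes t1 t2 d1 d2 kt kd :: real
  assumes t: "t = Complex (t1 / kt) (t2 / kt)" and d: "d = Complex (d1 / kd) (d2 / kd)"
    and pos: "0 < - 99 * (t1 * kd^2 - (t1 * d1 + t2 * d2) * kd)
      - 14 * (t2 * kd^2 - (t1 * d2 - t2 * d1) * kd) + 100 * kt * (d1^2 + d2^2 - kd^2)"
      (is "0 < ?F")
    and k: "kt > 0" "kd > 0"
  shows "1 - (cmod d)\<^sup>2 < cmod (t - cnj t * d)"
proof -
  define c where "c = Complex (- 99/100) (14/100)"
  define w where "w = t - cnj t * d"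
  have "0 < ?F / (100 * kt * kd^2)"
    using pos k by (intro divide_pos_pos) simp_all
  also have "\<dots> = Re (c * w) + (cmod d)\<^sup>2 - 1"
    unfolding cmod_power2 using k by (simp add: c_def w_def t d power2_eq_square field_simps)
  finally have "1 - (cmod d)\<^sup>2 < Re (c * w)" by simp
  also have "\<dots> \<le> cmod (c * w)" by (rule complex_Re_le_cmod)
  also have "\<dots> \<le> 1 * cmod w"
    \<comment> \<open>\<open>c\<close> lies in the unit disc because
      \<open>99^2 + 14^2 = 9997 < 100^2\<close>.\<close>
    unfolding norm_mult by (intro mult_right_mono) (simp_all add: c_def cmod_def power2_eq_square)
  finally show ?thesis by (simp add: w_def)
qed

theorem theorem2p2:
  fixes \<nu> :: real
  assumes "\<nu> > 0"
    and "scheme_stable \<nu>"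
  shows "\<nu> < 0.825"
proof (rule ccontr)
  assume "\<not> \<nu> < 0.825"
  then have \<nu>: "33/40 \<le> \<nu>" by simp
  let ?G = "amplification \<nu> unstable_phase"
  have "cmod unstable_phase = 1"
    by (simp add: unstable_phase_def cmod_def power2_eq_square)
  from stable_imp_schur_cohn[OF assms this]
  have "cmod (trace ?G - cnj (trace ?G) * det ?G) \<le> 1 - (cmod (det ?G))\<^sup>2" .
  moreover have "1 - (cmod (det ?G))\<^sup>2 < cmod (trace ?G - cnj (trace ?G) * det ?G)"
    by (rule schur_cohn_violated[OF trace_amplification_unstable_phase
          det_amplification_unstable_phase schur_cohn_polynomial_pos[OF \<nu>]]) simp_all
  ultimately show False by linarith
qed

end
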